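(* Let $T=\mathbb Ze\oplus\mathbb Zf$ (free abelian of rank two), $\Gamma=\mathbb Z$, and let $[\cdot,\cdot,\cdot]$ be the trilinear product on $T$ with $[e,e,e]=f$ and every other product of basis elements equal to zero. This defines an additive ternary $\mathbb Z$-ring, and it is not induced by any associative $\mathbb Z$-bilinear binary multiplication on $T$.
   Context: An additive ternary $\Gamma$-ring consists of abelian groups $(T,+)$, $(\Gamma,+)$ and a map $T\times\Gamma\times T\times\Gamma\times T\to T$, $(x,\alpha,y,\beta,z)\mapsto x\alpha y\beta z$, additive in each of the five variables, with $(x\alpha y\beta z)\gamma u\delta v=x\alpha(y\beta z\gamma u)\delta v=x\alpha y\beta(z\gamma u\delta v)$. A trilinear product $[\cdot,\cdot,\cdot]$ on $T$ gives the operation with $\Gamma=\mathbb Z$ by $x\,n\,y\,m\,z=nm[x,y,z]$. It is induced by an associative $\mathbb Z$-bilinear binary multiplication $\star$ on $T$ if $[x,y,z]=(x\star y)\star z$ for all $x,y,z\in T$. *)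

theory Defs
  imports Complex_Main "HOL-Library.Product_Plus"
begin

(* the canonical action of the integers on an abelian group *)
definition int_scale :: "int \<Rightarrow> 'a::ab_group_add \<Rightarrow> 'a" where
  "int_scale k x = (\<Sum>i<nat k. x) - (\<Sum>i<nat (- k). x)"

lemma int_scale_diff:
  "int_scale (int m - int n) x = (\<Sum>i<m. x) - (\<Sum>i<n. x)"
proof -
  have split: "(\<Sum>i<a + b. x) = (\<Sum>i<a. x) + (\<Sum>i<b. x)" for a b :: nat
    by (induction b) (simp_all add: algebra_simps)
  show ?thesis
  proof (cases "n \<le> m")
    case True
    then obtain d where "m = n + d" by (auto simp: le_iff_add)
    then show ?thesis by (simp add: int_scale_def split)
  next
    case False
    then obtain d where "n = m + d" using nat_le_iff_add[of m n] by auto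
    then show ?thesis by (simp add: int_scale_def split)
  qed
qed

lemma int_scale_add_left: "int_scale (k + l) x = int_scale k x + int_scale l x"
proof -
  obtain a b c d where kl: "k = int a - int b" "l = int c - int d"
    by (metis int_diff_cases)
  have split: "(\<Sum>i<a + b. x) = (\<Sum>i<a. x) + (\<Sum>i<b. x)" for a b :: nat
    by (induction b) (simp_all add: algebra_simps)
  have "k + l = int (a + c) - int (b + d)" using kl by simp
  then have "int_scale (k + l) x = (\<Sum>i<a + c. x) - (\<Sum>i<b + d. x)"
    by (simp only: int_scale_diff)
  then show ?thesis unfolding kl int_scale_diff split by (simp add: algebra_simps)
qed

lemma int_scale_zero_left [simp]: "int_scale 0 x = 0"
  by (simp add: int_scale_def)

lemma int_scale_one [simp]: "int_scale 1 x = x"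
  by (simp add: int_scale_def)

lemma int_scale_minus_left: "int_scale (- k) x = - int_scale k x"
  by (simp add: int_scale_def)

lemma int_scale_add_right: "int_scale k (x + y) = int_scale k x + int_scale k y"
  by (simp add: int_scale_def sum.distrib)

lemma int_scale_assoc: "int_scale k (int_scale l x) = int_scale (k * l) x"
proof (induction k rule: int_induct [where k = 0])
  case base
  show ?case by simp
next
  case (step1 i)
  then show ?case by (simp add: int_scale_add_left distrib_right)
next
  case (step2 i)
  have "int_scale (i - 1) y = int_scale i y - y" for y :: 'a
    using int_scale_add_left [of "i - 1" 1 y] by (simp add: algebra_simps)
  moreover have "int_scale ((i - 1) * l) x = int_scale (i * l) x - int_scale l x"
    using int_scale_add_left [of "(i - 1) * l" l x] by (simp add: algebra_simps)
  ultimately show ?case using step2 by simp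
qed

interpretation int_module: module int_scale
  by unfold_locales
    (simp_all add: int_scale_add_left int_scale_add_right int_scale_assoc)

lemma int_scale_int: "int_scale k (n :: int) = k * n"
proof -
  have "int (nat k) - int (nat (- k)) = k" by simp
  moreover have "int_scale k n = (int (nat k) - int (nat (- k))) * n"
    by (simp only: int_scale_def sum_constant card_lessThan left_diff_distrib)
  ultimately show ?thesis by simp
qed

lemma int_scale_prod: "int_scale k (x, y) = (int_scale k x, int_scale k y)"
proof -
  have "(\<Sum>i<n. (x, y)) = ((\<Sum>i<n. x), (\<Sum>i<n. y))" for n :: nat
    by (induction n) (simp_all add: zero_prod_def)
  then show ?thesis by (simp add: int_scale_def)
qed

abbreviation int_linear :: "('a::ab_group_add \<Rightarrow> 'b::ab_group_add) \<Rightarrow> bool" where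
  "int_linear \<equiv> module_hom int_scale int_scale"

definition int_bilinear :: "('a::ab_group_add \<Rightarrow> 'a \<Rightarrow> 'a) \<Rightarrow> bool" where
  "int_bilinear m \<longleftrightarrow>
    (\<forall>y. int_linear (\<lambda>x. m x y)) \<and>
    (\<forall>x. int_linear (\<lambda>y. m x y))"

definition int_trilinear :: "('a::ab_group_add \<Rightarrow> 'a \<Rightarrow> 'a \<Rightarrow> 'a) \<Rightarrow> bool" where
  "int_trilinear br \<longleftrightarrow>
    (\<forall>y z. int_linear (\<lambda>x. br x y z)) \<and>
    (\<forall>x z. int_linear (\<lambda>y. br x y z)) \<and>
    (\<forall>x y. int_linear (\<lambda>z. br x y z))"

locale ternary_Gamma_ring =
  fixes op :: "'t::ab_group_add \<Rightarrow> 'g::ab_group_add \<Rightarrow> 't \<Rightarrow> 'g \<Rightarrow> 't \<Rightarrow> 't"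
  assumes additive_1: "additive (\<lambda>x. op x \<alpha> y \<beta> z)"
    and additive_2: "additive (\<lambda>\<alpha>. op x \<alpha> y \<beta> z)"
    and additive_3: "additive (\<lambda>y. op x \<alpha> y \<beta> z)"
    and additive_4: "additive (\<lambda>\<beta>. op x \<alpha> y \<beta> z)"
    and additive_5: "additive (\<lambda>z. op x \<alpha> y \<beta> z)"
    and assoc_left_middle:
      "op (op x \<alpha> y \<beta> z) \<gamma> u \<delta> v = op x \<alpha> (op y \<beta> z \<gamma> u) \<delta> v"
    and assoc_middle_right:
      "op x \<alpha> (op y \<beta> z \<gamma> u) \<delta> v = op x \<alpha> y \<beta> (op z \<gamma> u \<delta> v)"

definition int_Gamma_op ::
  "('a::ab_group_add \<Rightarrow> 'a \<Rightarrow> 'a \<Rightarrow> 'a) \<Rightarrow> 'a \<Rightarrow> int \<Rightarrow> 'a \<Rightarrow> int \<Rightarrow> 'a \<Rightarrow> 'a" where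
  "int_Gamma_op br x n y m z = int_scale (n * m) (br x y z)"

definition induced_by_binary ::
  "('a::ab_group_add \<Rightarrow> 'a \<Rightarrow> 'a \<Rightarrow> 'a) \<Rightarrow> ('a \<Rightarrow> 'a \<Rightarrow> 'a) \<Rightarrow> bool" where
  "induced_by_binary br star \<longleftrightarrow>
    (\<forall>x y z. br x y z = star (star x y) z)"

type_synonym T = "int \<times> int"

definition basis_e :: T where "basis_e = (1, 0)"

definition basis_f :: T where "basis_f = (0, 1)"

lemma basis_expansion: "(a, b) = int_scale a basis_e + int_scale b basis_f"
  by (simp add: basis_e_def basis_f_def int_scale_prod int_scale_int)

definition basis_products :: "(T \<Rightarrow> T \<Rightarrow> T \<Rightarrow> T) \<Rightarrow> bool" where
  "basis_products br \<longleftrightarrow>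
    br basis_e basis_e basis_e = basis_f \<and>
    (\<forall>x\<in>{basis_e, basis_f}. \<forall>y\<in>{basis_e, basis_f}. \<forall>z\<in>{basis_e, basis_f}. (x, y, z) \<noteq> (basis_e, basis_e, basis_e) \<longrightarrow>
      br x y z = 0)"

end

theory Submission imports Defs begin

text \<open>
  Suppose \<open>\<star>\<close> is associative, bilinear and induces the product, and write
  \<open>e \<star> e = a e + b f\<close>. Then \<open>f \<star> e = (e \<star> e) \<star> (e \<star> e) = [e, e, e \<star> e] = a f\<close>, so
  \<open>f = (e \<star> e) \<star> e = a (a e + b f) + a b f\<close>. Comparing the coefficients of \<open>e\<close> gives \<open>a = 0\<close>,
  and then \<open>f = 0\<close>, a contradiction.
\<close>

text \<open>Closed form of the trilinear extension of the basis table: \<open>fst\<close> reads off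
  the coefficient of e, so the ring laws become computations in coordinates.\<close>

definition cube_bracket :: "T \<Rightarrow> T \<Rightarrow> T \<Rightarrow> T" where
  "cube_bracket x y z = (0, fst x * fst y * fst z)"

lemma int_scale_T: "int_scale k (x :: T) = (k * fst x, k * snd x)"
  by (cases x) (simp add: int_scale_prod int_scale_int)

lemma int_linearI:
  assumes "\<And>x y. g (x + y) = g x + g y" and "\<And>k x. g (int_scale k x) = int_scale k (g x)"
  shows "int_linear g"
  using assms by unfold_locales

lemma int_linear_T: "int_linear g \<Longrightarrow> g (a, b) = int_scale a (g basis_e) + int_scale b (g basis_f)"
  by (simp add: basis_expansion module_hom.add module_hom.scale)

lemma cube_bracket_trilinear: "int_trilinear cube_bracket"
  unfolding int_trilinear_def
  by (intro conjI allI int_linearI)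
    (simp_all add: cube_bracket_def int_scale_T algebra_simps)

lemma cube_bracket_basis: "basis_products cube_bracket"
  by (auto simp: basis_products_def cube_bracket_def basis_e_def basis_f_def zero_prod_def)

text \<open>Expanding all three arguments in the basis leaves only the e, e, e term. This carries
  the facts about \<open>cube_bracket\<close> over to every \<open>br\<close> in the
  theorem.\<close>

lemma trilinear_basis_products_unique:
  assumes "int_trilinear br" and "basis_products br"
  shows "br = cube_bracket"
proof (intro ext)
  fix x y z :: T
  have lin: "int_linear (\<lambda>x. br x y z)" "int_linear (\<lambda>y. br x y z)" "int_linear (\<lambda>z. br x y z)"
    for x y z
    using assms(1) unfolding int_trilinear_def by blast+
  have ne: "basis_f \<noteq> basis_e"
    by (simp add: basis_e_def basis_f_def)
  have basis: "br basis_e basis_e basis_e = basis_f"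
      "br basis_e basis_e basis_f = 0" "br basis_e basis_f basis_e = 0"
      "br basis_e basis_f basis_f = 0" "br basis_f basis_e basis_e = 0"
      "br basis_f basis_e basis_f = 0" "br basis_f basis_f basis_e = 0"
      "br basis_f basis_f basis_f = 0"
    using assms(2) ne by (auto simp: basis_products_def)
  obtain a b c d g h where xyz: "x = (a, b)" "y = (c, d)" "z = (g, h)"
    by (metis surj_pair)
  have "br x y z = int_scale a (int_scale c (int_scale g basis_f))"
    by (simp add: xyz int_linear_T[OF lin(1)] int_linear_T[OF lin(2)] int_linear_T[OF lin(3)] basis mult.commute mult.left_commute)
  then show "br x y z = cube_bracket x y z"
    by (simp add: xyz cube_bracket_def int_scale_T basis_f_def)
qed

text \<open>Both associativity laws hold because every nested product vanishes: a bracket has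
  e-coefficient 0, and brackets see only e-coefficients.\<close>

lemma cube_bracket_ternary_Gamma_ring: "ternary_Gamma_ring (int_Gamma_op cube_bracket)"
  by unfold_locales (simp_all add: int_Gamma_op_def cube_bracket_def int_scale_T algebra_simps)

lemma cube_bracket_not_induced:
  assumes "int_bilinear star" and "semigroup star" and "induced_by_binary cube_bracket star"
  shows False
proof -
  obtain a b where ee: "star basis_e basis_e = (a, b)"
    by fastforce
  have lin: "int_linear (\<lambda>x. star x basis_e)"
    using assms(1) unfolding int_bilinear_def by blast
  have ind: "star (star x y) z = cube_bracket x y z" for x y z
    using assms(3) unfolding induced_by_binary_def by metis
  have eee: "star (a, b) basis_e = basis_f"
    using ind[of basis_e basis_e basis_e]
    unfolding ee by (simp add: cube_bracket_def basis_e_def basis_f_def)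
  have "star basis_f basis_e = star (a, b) (star basis_e basis_e)"
    by (simp add: semigroup.assoc[OF assms(2), symmetric] eee)
  also have "\<dots> = (0, a)"
    \<comment> \<open>By \<open>ee\<close>, the pair \<open>(a, b)\<close> is also the left factor e
      \<star> e, so the product is the bracket of e, e and \<open>(a, b)\<close>.\<close>
    using ind[of basis_e basis_e "(a, b)"] unfolding ee by (simp add: cube_bracket_def basis_e_def)
  finally have "(0, 1) = int_scale a (a, b) + int_scale b (0, a)"
    using int_linear_T[OF lin, of a b] by (simp add: eee ee basis_f_def)
  \<comment> \<open>The coordinates read 0 = a * a and 1 = 2 * a * b.\<close>
  then show False
    by (auto simp: int_scale_T)
qed

theorem proposition14p1:
  "(\<exists>!br. int_trilinear br \<and> basis_products br) \<and>
   (\<forall>br. int_trilinear br \<and> basis_products br \<longrightarrow>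
      ternary_Gamma_ring (int_Gamma_op br) \<and>
      \<not> (\<exists>star. int_bilinear star \<and> semigroup star \<and> induced_by_binary br star))"
  using cube_bracket_trilinear cube_bracket_basis trilinear_basis_products_unique
    cube_bracket_ternary_Gamma_ring cube_bracket_not_induced
  by blast

end
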